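(* Let $a>0$, $b>0$ and $\nu>-\tfrac12$ be real numbers with $a\ge b$. Then $$\sum_{n=1}^\infty \frac{e^{-an}}{(\frac12 bn)^\nu}\,J_\nu(bn)=\sum_{k=0}^\infty\frac{(-1)^k(\frac12 b)^{2k}}{k!\,\Gamma(1+\nu+k)}\,\mathrm{Li}_{-2k}(e^{-a}),$$ where the series on the right-hand side converges.
   Context: $J_\nu$ is the Bessel function of the first kind of order $\nu$, and $\mathrm{Li}_s(z)=\sum_{n=1}^\infty n^{-s}z^n$ (for $|z|<1$) is the polylogarithm function. *)

theory Defs
  imports "HOL-Analysis.Analysis"
begin

(* Only meant for x > 0, where the real power is single-valued; note that
   0 powr \<nu> = 0 makes the value at x = 0, \<nu> = 0 differ from the usual J_0(0) = 1.
   At the poles of the Gamma function, Gamma = 0 and division by 0 gives 0, which agrees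
   with the usual convention for 1/Gamma. *)
definition bessel_J :: "real \<Rightarrow> real \<Rightarrow> real" where
  "bessel_J \<nu> x =
     (\<Sum>k. (-1) ^ k / (fact k * Gamma (\<nu> + real k + 1)) * (x / 2) powr (2 * real k + \<nu>))"

(* Only meant for \<bar>z\<bar> < 1, where the series converges for every s. *)
definition polylog :: "real \<Rightarrow> real \<Rightarrow> real" where
  "polylog s z = (\<Sum>n. real (Suc n) powr (- s) * z ^ Suc n)"

end

theory Submission
  imports Defs "HOL-Complex_Analysis.Complex_Analysis"
begin

text \<open>
  Expanding the Bessel function and interchanging the two summations is legitimate for b < a, where
  the double series converges absolutely. For b = a it is only conditionally convergent, so b is
  replaced by a smaller value that tends to b. On the left, the normalised Bessel function is bounded
  by its value at 0 and dominated convergence applies. On the right, the moments sum n^m e^(-an)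
  are m! times the Taylor coefficients at w = 0 of 1 / (e^(a-w) - 1). Subtracting the pole 1 / (a - w)
  leaves a function holomorphic for |w| < sqrt (a^2 + 4 pi^2), hence an absolutely convergent
  series, while the pole contributes an alternating series with terms decreasing to 0, to which
  Abel's limit theorem applies.
\<close>

section \<open>Interchanging absolutely convergent double series\<close>

text \<open>Summable row sums of the norms make the norm summable over all pairs of indices. The
  family then has one unconditional sum \<open>T\<close>, and summing by rows or by columns both
  give \<open>T\<close>.\<close>

lemma double_series_swap:
  fixes f :: "nat \<Rightarrow> nat \<Rightarrow> 'a :: banach"
  assumes row: "\<And>n. summable (\<lambda>m. norm (f n m))"
    and rows: "summable (\<lambda>n. \<Sum>m. norm (f n m))"
  shows "summable (\<lambda>n. norm (f n m))"
    and "(\<lambda>m. \<Sum>n. f n m) sums (\<Sum>n. \<Sum>m. f n m)"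
proof -
  have norm_summable: "(\<lambda>(n, m). norm (f n m)) summable_on UNIV \<times> UNIV"
  proof (rule summable_on_SigmaI)
    show "((\<lambda>m. case (n, m) of (n, m) \<Rightarrow> norm (f n m)) has_sum (\<Sum>m. norm (f n m))) UNIV" for n
      using row[of n] by (auto intro!: sums_nonneg_imp_has_sum summable_sums)
    show "(\<lambda>n. \<Sum>m. norm (f n m)) summable_on UNIV"
      using rows by (subst summable_on_UNIV_nonneg_real_iff) (auto intro!: suminf_nonneg row)
  qed auto
  then have norm_summable': "(\<lambda>(m, n). norm (f n m)) summable_on UNIV \<times> UNIV"
    by (subst summable_on_swap) (simp only: case_prod_conv)
  have col: "summable (\<lambda>n. norm (f n m))" for m
    using summable_on_SigmaD1[OF norm_summable', of m] by (simp add: summable_on_UNIV_nonneg_real_iff)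
  then show "summable (\<lambda>n. norm (f n m))" .
  have "(\<lambda>(n, m). f n m) summable_on UNIV \<times> UNIV"
    by (rule abs_summable_summable) (use norm_summable in \<open>simp add: case_prod_unfold\<close>)
  then obtain T where T: "((\<lambda>(n, m). f n m) has_sum T) (UNIV \<times> UNIV)"
    by (auto simp: summable_on_def)
  then have T': "((\<lambda>(m, n). f n m) has_sum T) (UNIV \<times> UNIV)"
    by (subst has_sum_swap) (simp only: case_prod_conv)
  have "((\<lambda>n. \<Sum>m. f n m) has_sum T) UNIV"
  proof (rule has_sum_SigmaD[OF T])
    show "((\<lambda>m. case (n, m) of (n, m) \<Rightarrow> f n m) has_sum (\<Sum>m. f n m)) UNIV" for n
      unfolding case_prod_conv
      by (rule norm_summable_imp_has_sum[OF row summable_sums[OF summable_norm_cancel[OF row]]])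
  qed
  moreover have "((\<lambda>m. \<Sum>n. f n m) has_sum T) UNIV"
  proof (rule has_sum_SigmaD[OF T'])
    show "((\<lambda>n. case (m, n) of (m, n) \<Rightarrow> f n m) has_sum (\<Sum>n. f n m)) UNIV" for m
      unfolding case_prod_conv
      by (rule norm_summable_imp_has_sum[OF col summable_sums[OF summable_norm_cancel[OF col]]])
  qed
  ultimately show "(\<lambda>m. \<Sum>n. f n m) sums (\<Sum>n. \<Sum>m. f n m)"
    using sums_unique[OF has_sum_imp_sums] has_sum_imp_sums by fastforce
qed

section \<open>Coefficients of the normalised Bessel function\<close>

definition bessel_coeff :: "real \<Rightarrow> nat \<Rightarrow> real" where
  "bessel_coeff \<nu> k = (-1) ^ k / (4 ^ k * fact k * Gamma (1 + \<nu> + real k))"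

text \<open>The argument is the square of the usual one: J(x) = (x / 2) powr \<nu> * bessel_entire \<nu> (x^2).\<close>
definition bessel_entire :: "real \<Rightarrow> real \<Rightarrow> real" where
  "bessel_entire \<nu> y = (\<Sum>k. bessel_coeff \<nu> k * y ^ k)"

text \<open>The factor (2k)! is the growth of the moment of order 2k that multiplies the k-th
  coefficient: the pole 1 / (a - w) contributes (2k)! / a^(2k+1) to it, so the weight is what
  remains after the factorials cancel.\<close>

definition bessel_weight :: "real \<Rightarrow> nat \<Rightarrow> real" where
  "bessel_weight \<nu> k = fact (2 * k) / (4 ^ k * fact k * Gamma (1 + \<nu> + real k))"

lemma bessel_coeff_eq_weight: "bessel_coeff \<nu> k = (-1) ^ k * bessel_weight \<nu> k / fact (2 * k)"
  by (simp add: bessel_coeff_def bessel_weight_def)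

lemma bessel_weight_pos:
  assumes "\<nu> > - 1 / 2"
  shows "bessel_weight \<nu> k > 0"
  using assms by (auto simp: bessel_weight_def intro!: divide_pos_pos mult_pos_pos Gamma_real_pos)

text \<open>The functional equation of Gamma supplies the denominator, and (2k+2)! = 4 (k+1) (k+1/2)
  (2k)! the numerator. The ratio is below 1 because \<nu> > -1/2, which is where this bound
  enters.\<close>

lemma bessel_weight_Suc:
  assumes "\<nu> > - 1 / 2"
  shows "bessel_weight \<nu> (Suc k) = bessel_weight \<nu> k * ((1 / 2 + real k) / (1 + \<nu> + real k))"
proof -
  have pos: "1 + \<nu> + real k > 0" using assms by simp
  then have "1 + \<nu> + real k \<notin> \<int>\<^sub>\<le>\<^sub>0" by (auto elim!: nonpos_Ints_cases)
  then have "Gamma (1 + \<nu> + real (Suc k)) = (1 + \<nu> + real k) * Gamma (1 + \<nu> + real k)"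
    using Gamma_plus1[of "1 + \<nu> + real k"] by (simp add: algebra_simps)
  moreover have "fact (2 * Suc k) = (4 * real (Suc k) * (1 / 2 + real k)) * fact (2 * k)"
    by (simp add: algebra_simps)
  ultimately show ?thesis
    using pos Gamma_real_pos[OF pos] by (simp add: bessel_weight_def divide_simps) (simp add: algebra_simps)
qed

lemma bessel_weight_decseq:
  assumes "\<nu> > - 1 / 2"
  shows "decseq (bessel_weight \<nu>)"
proof (rule decseq_SucI)
  fix k
  have "(1 / 2 + real k) / (1 + \<nu> + real k) \<le> 1"
    using assms by (simp add: divide_le_eq)
  then show "bessel_weight \<nu> (Suc k) \<le> bessel_weight \<nu> k"
    unfolding bessel_weight_Suc[OF assms]
    using bessel_weight_pos[OF assms, of k] by (intro mult_left_le) auto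
qed

text \<open>The weight is a quotient of Pochhammer symbols of 1/2 and 1 + \<nu>, up to a constant.
  Euler's limit formula for 1/Gamma, applied to both, shows that it decays like k^(-(\<nu> +
  1/2)).\<close>

lemma bessel_weight_tendsto_0:
  assumes "\<nu> > - 1 / 2"
  shows "bessel_weight \<nu> \<longlonglongrightarrow> 0"
proof -
  have pos: "1 + \<nu> > 0" using assms by simp
  then have nonpole: "1 + \<nu> \<notin> \<int>\<^sub>\<le>\<^sub>0" by (auto elim!: nonpos_Ints_cases)
  have weight: "bessel_weight \<nu> k = pochhammer (1 / 2) k / pochhammer (1 + \<nu>) k / Gamma (1 + \<nu>)" for k
  proof (induction k)
    case 0
    then show ?case by (simp add: bessel_weight_def)
  next
    case (Suc k)
    then show ?case by (simp add: bessel_weight_Suc[OF assms] pochhammer_rec' field_simps)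
  qed
  have nonzero: "rGamma (1 + \<nu>) \<noteq> 0" using nonpole by (simp add: rGamma_eq_zero_iff)
  have "(\<lambda>k. rGamma_series (1 / 2) k / rGamma_series (1 + \<nu>) k) \<longlonglongrightarrow> rGamma (1 / 2) / rGamma (1 + \<nu>)"
    using nonzero by (intro tendsto_intros)
  moreover have "((\<lambda>k. exp (- (\<nu> + 1 / 2) * ln (real k))) \<longlonglongrightarrow> 0)"
    using assms by real_asymp
  ultimately have "(\<lambda>k. rGamma_series (1 / 2) k / rGamma_series (1 + \<nu>) k
        * exp (- (\<nu> + 1 / 2) * ln (real k)) / Gamma (1 + \<nu>))
      \<longlonglongrightarrow> rGamma (1 / 2) / rGamma (1 + \<nu>) * 0 / Gamma (1 + \<nu>)"
    using Gamma_real_pos[OF pos] nonzero by (intro tendsto_mult tendsto_divide tendsto_const rGamma_series_LIMSEQ) auto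
  \<comment> \<open>\<open>rGamma_series z k\<close> contains the Pochhammer symbol of length k + 1,
    hence the weight at \<open>Suc k\<close>. The factorials cancel, and the extra exponential
    removes the remaining power of k.\<close>
  moreover have "rGamma_series (1 / 2) k / rGamma_series (1 + \<nu>) k
        * exp (- (\<nu> + 1 / 2) * ln (real k)) / Gamma (1 + \<nu>) = bessel_weight \<nu> (Suc k)" for k
  proof -
    have exp_eq: "exp ((1 + \<nu>) * ln (real k)) * exp (- (\<nu> + 1 / 2) * ln (real k)) = exp (1 / 2 * ln (real k))"
      by (simp add: algebra_simps flip: exp_add)
    have cancel: "P / (F * E) / (Q / (F * E')) * X / G = P / Q / G"
      if "E' * X = E" "F \<noteq> 0" "E \<noteq> 0" for P Q E E' F X G :: real
    proof -
      have "P / (F * E) / (Q / (F * E')) * X / G = P / Q / G * (E' * X / E)"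
        using that(2) by (simp add: mult_ac)
      with that show ?thesis by simp
    qed
    show ?thesis
      unfolding weight rGamma_series_def of_real_eq_id id_apply Suc_eq_plus1
      by (rule cancel[OF exp_eq]) auto
  qed
  ultimately have "(\<lambda>k. bessel_weight \<nu> (Suc k)) \<longlonglongrightarrow> 0" by simp
  then show ?thesis by (rule LIMSEQ_imp_Suc)
qed

text \<open>With (2k)! in the denominator the power series can be compared with the even part of the
  exponential series.\<close>

lemma abs_bessel_coeff_le:
  assumes "\<nu> > - 1 / 2"
  shows "\<bar>bessel_coeff \<nu> k\<bar> \<le> bessel_weight \<nu> 0 / fact (2 * k)"
proof -
  have "\<bar>bessel_coeff \<nu> k\<bar> = bessel_weight \<nu> k / fact (2 * k)"
    unfolding bessel_coeff_eq_weight abs_divide abs_mult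
    using bessel_weight_pos[OF assms, of k] by simp
  also have "\<dots> \<le> bessel_weight \<nu> 0 / fact (2 * k)"
    using decseqD[OF bessel_weight_decseq[OF assms], of 0 k] by (intro divide_right_mono) auto
  finally show ?thesis .
qed

lemma summable_bessel_coeff:
  assumes "\<nu> > - 1 / 2"
  shows "summable (\<lambda>k. norm (bessel_coeff \<nu> k * y ^ k))"
proof (rule summable_comparison_test')
  show "summable (\<lambda>k. bessel_weight \<nu> 0 * (inverse (fact k) * \<bar>y\<bar> ^ k))"
    by (intro summable_mult summable_exp)
  fix k :: nat
  have "bessel_weight \<nu> 0 / fact (2 * k) \<le> bessel_weight \<nu> 0 / fact k"
    using bessel_weight_pos[OF assms, of 0] by (intro divide_left_mono fact_mono) auto
  with abs_bessel_coeff_le[OF assms, of k]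
  have "\<bar>bessel_coeff \<nu> k\<bar> \<le> bessel_weight \<nu> 0 / fact k" by simp
  then have "\<bar>bessel_coeff \<nu> k\<bar> * \<bar>y\<bar> ^ k \<le> bessel_weight \<nu> 0 / fact k * \<bar>y\<bar> ^ k"
    by (rule mult_right_mono) auto
  then show "norm (norm (bessel_coeff \<nu> k * y ^ k)) \<le> bessel_weight \<nu> 0 * (inverse (fact k) * \<bar>y\<bar> ^ k)"
    by (simp add: abs_mult power_abs divide_inverse mult.assoc)
qed

lemma bessel_J_conv_entire:
  assumes "\<nu> > - 1 / 2" "x > 0"
  shows "bessel_J \<nu> x / (x / 2) powr \<nu> = bessel_entire \<nu> (x\<^sup>2)"
proof -
  have "(x / 2) powr (2 * real k + \<nu>) = (x / 2) powr \<nu> * ((x\<^sup>2) ^ k / 4 ^ k)" for k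
  proof -
    have "(x / 2) powr (2 * real k) = ((x / 2)\<^sup>2) ^ k"
      using assms powr_realpow[of "x / 2" "2 * k"] by (simp add: power_mult)
    then show ?thesis
      by (simp add: powr_add power_divide)
  qed
  then have "bessel_J \<nu> x = (\<Sum>k. (x / 2) powr \<nu> * (bessel_coeff \<nu> k * (x\<^sup>2) ^ k))"
    unfolding bessel_J_def bessel_coeff_def
    by (intro suminf_cong) (simp add: add_ac mult_ac)
  also have "\<dots> = (x / 2) powr \<nu> * bessel_entire \<nu> (x\<^sup>2)"
    unfolding bessel_entire_def
    by (intro suminf_mult summable_norm_cancel[OF summable_bessel_coeff] assms)
  finally show ?thesis using assms by simp
qed

section \<open>Boundedness of the normalised Bessel function\<close>

text \<open>In the variable x = sqrt y the function solves the damped oscillator equation f'' + (2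
  \<nu> + 1) / x * f' + f = 0. The damping is positive for \<nu> > -1/2, so the energy decreases
  from its value at 0, which is f(0)^2.\<close>

lemma bessel_entire_bound:
  assumes "\<nu> > - 1 / 2" "y \<ge> 0"
  shows "\<bar>bessel_entire \<nu> y\<bar> \<le> \<bar>bessel_entire \<nu> 0\<bar>"
proof -
  define p where "p = bessel_coeff \<nu>"
  have summable: "summable (\<lambda>k. p k * y ^ k)" for y
    unfolding p_def by (rule summable_norm_cancel[OF summable_bessel_coeff[OF assms(1)]])
  have summable': "summable (\<lambda>k. diffs p k * y ^ k)" for y
    by (rule termdiff_converges_all[OF summable])
  have summable'': "summable (\<lambda>k. diffs (diffs p) k * y ^ k)" for y
    by (rule termdiff_converges_all[OF summable'])
  define B B' B'' where "B = (\<lambda>y. \<Sum>k. p k * y ^ k)" and "B' = (\<lambda>y. \<Sum>k. diffs p k * y ^ k)"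
    and "B'' = (\<lambda>y. \<Sum>k. diffs (diffs p) k * y ^ k)"
  have B: "(B has_field_derivative B' y) (at y)" for y
    unfolding B_def B'_def by (rule termdiffs_strong_converges_everywhere[OF summable])
  have B': "(B' has_field_derivative B'' y) (at y)" for y
    unfolding B'_def B''_def by (rule termdiffs_strong_converges_everywhere[OF summable'])
  \<comment> \<open>The recurrence 4 (k+1) (1 + \<nu> + k) p(k+1) = -p(k), arranged as the k-th
    coefficient of the differential equation.\<close>
  have coeff: "4 * (real k * diffs p k) + 4 * (1 + \<nu>) * diffs p k + p k = 0" for k
  proof -
    have pos: "1 + \<nu> + real k > 0" using assms by simp
    then have "1 + \<nu> + real k \<notin> \<int>\<^sub>\<le>\<^sub>0" by (auto elim!: nonpos_Ints_cases)
    then have "Gamma (1 + \<nu> + real (Suc k)) = (1 + \<nu> + real k) * Gamma (1 + \<nu> + real k)"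
      using Gamma_plus1[of "1 + \<nu> + real k"] by (simp add: algebra_simps)
    moreover have "Gamma (1 + \<nu> + real k) \<noteq> 0" using Gamma_real_pos[OF pos] by simp
    ultimately have "4 * (1 + \<nu> + real k) * (real (Suc k) * p (Suc k)) = - p k"
      using pos by (simp add: p_def bessel_coeff_def divide_simps)
    then show ?thesis by (simp add: diffs_def algebra_simps)
  qed
  have ode: "4 * (y * B'' y) + 4 * (1 + \<nu>) * B' y + B y = 0" for y
  proof -
    \<comment> \<open>Multiplication by y shifts the index by one; the new coefficient
      \<open>real k * diffs p k\<close> vanishes at k = 0, so all three series can be added
      termwise.\<close>
    have "(\<lambda>k. y * (diffs (diffs p) k * y ^ k)) sums (y * B'' y)"
      unfolding B''_def by (intro sums_mult summable_sums summable'')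
    then have "(\<lambda>k. real (Suc k) * diffs p (Suc k) * y ^ Suc k) sums (y * B'' y)"
      by (simp add: diffs_def mult_ac)
    then have "(\<lambda>k. real k * diffs p k * y ^ k) sums (y * B'' y)"
      by (subst (asm) sums_Suc_iff) simp
    moreover have "(\<lambda>k. diffs p k * y ^ k) sums B' y" "(\<lambda>k. p k * y ^ k) sums B y"
      unfolding B_def B'_def by (intro summable_sums summable summable')+
    ultimately have "(\<lambda>k. 4 * (real k * diffs p k * y ^ k) + 4 * (1 + \<nu>) * (diffs p k * y ^ k) + p k * y ^ k)
        sums (4 * (y * B'' y) + 4 * (1 + \<nu>) * B' y + B y)"
      by (intro sums_add sums_mult)
    moreover have "4 * (real k * diffs p k * y ^ k) + 4 * (1 + \<nu>) * (diffs p k * y ^ k) + p k * y ^ k = 0" for k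
      using arg_cong[OF coeff[of k], of "\<lambda>z. z * y ^ k"] by (simp add: algebra_simps)
    ultimately show ?thesis by (simp add: sums_iff)
  qed
  \<comment> \<open>In the variable x = sqrt y this is the energy f'(x)^2 + f(x)^2 of f(x) = B(x^2).\<close>
  define E where "E = (\<lambda>y. 4 * y * (B' y)\<^sup>2 + (B y)\<^sup>2)"
  have E: "(E has_field_derivative - (4 * (1 + 2 * \<nu>) * (B' y)\<^sup>2)) (at y)" for y
  proof -
    have "(E has_field_derivative (4 * (B' y)\<^sup>2 + 8 * y * B' y * B'' y + 2 * B y * B' y)) (at y)"
      unfolding E_def by (rule derivative_eq_intros B B' refl)+ (simp add: algebra_simps)
    \<comment> \<open>The differential equation is split off as a factor, so that only the
      dissipative term survives.\<close>
    also have "4 * (B' y)\<^sup>2 + 8 * y * B' y * B'' y + 2 * B y * B' y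
        = 2 * B' y * (4 * (y * B'' y) + 4 * (1 + \<nu>) * B' y + B y) - 4 * (1 + 2 * \<nu>) * (B' y)\<^sup>2"
      by (simp add: algebra_simps power2_eq_square)
    finally show ?thesis unfolding ode by simp
  qed
  have "E y \<le> E 0"
  proof (rule DERIV_nonpos_imp_nonincreasing[OF assms(2)])
    show "\<exists>d. (E has_real_derivative d) (at x) \<and> d \<le> 0" for x
      using E[of x] assms(1) by (auto intro!: exI mult_nonneg_nonneg)
  qed
  then have "4 * y * (B' y)\<^sup>2 + (B y)\<^sup>2 \<le> (B 0)\<^sup>2" by (simp add: E_def)
  moreover have "4 * y * (B' y)\<^sup>2 \<ge> 0" using assms by simp
  ultimately have "(B y)\<^sup>2 \<le> (B 0)\<^sup>2" by linarith
  then show ?thesis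
    by (simp add: abs_le_square_iff bessel_entire_def B_def p_def)
qed


lemma bessel_entire_isCont:
  assumes "\<nu> > - 1 / 2"
  shows "isCont (bessel_entire \<nu>) y"
  using DERIV_isCont[OF termdiffs_strong_converges_everywhere[OF
      summable_norm_cancel[OF summable_bessel_coeff[OF assms]]]]
  by (simp add: bessel_entire_def[abs_def])

section \<open>Exponential moments and their generating function\<close>

text \<open>For a > 0 this is the polylogarithm of order -m at exp(-a), written with a
  natural-number power.\<close>

definition exp_moment :: "real \<Rightarrow> nat \<Rightarrow> real" where
  "exp_moment a m = (\<Sum>n. real (Suc n) ^ m * exp (- a * real (Suc n)))"

lemma geometric_exp_sums:
  fixes z :: "'a :: {real_normed_field, banach}"
  assumes "norm (exp z) < 1"
  shows "(\<lambda>n. exp (of_nat (Suc n) * z)) sums (1 / (exp (- z) - 1))"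
proof -
  have "(\<lambda>n. exp z * exp z ^ n) sums (exp z * (1 / (1 - exp z)))"
    by (intro sums_mult geometric_sums assms)
  moreover have "exp z * exp z ^ n = exp (of_nat (Suc n) * z)" for n
    by (simp only: exp_of_nat_mult power_Suc)
  moreover have "exp z * (1 / (1 - exp z)) = 1 / (exp (- z) - 1)"
    using assms by (auto simp: exp_minus divide_simps)
  ultimately show ?thesis by simp
qed

lemma summable_exp_moment:
  assumes "a > 0"
  shows "summable (\<lambda>n. real (Suc n) ^ m * exp (- a * real (Suc n)))"
proof (rule summable_comparison_test_bigo)
  show "summable (\<lambda>n. norm (exp (of_nat (Suc n) * (- a / 2))))"
    using geometric_exp_sums[of "- a / 2"] assms by (simp add: sums_iff)
  show "(\<lambda>n. real (Suc n) ^ m * exp (- a * real (Suc n))) \<in> O(\<lambda>n. exp (of_nat (Suc n) * (- a / 2)))"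
    using assms by real_asymp
qed

text \<open>Expand exp(n w) in the geometric series of exp(-n (a - w)) and interchange the sums. The
  row sums of the norms are exp(n (|w| - a)), a convergent geometric series since |w| < a.\<close>

lemma exp_moment_generating_function:
  assumes "norm (w :: complex) < a"
  shows "(\<lambda>m. of_real (exp_moment a m / fact m) * w ^ m) sums (1 / (exp (of_real a - w) - 1))"
proof -
  define f where "f n m = exp (- a * real (Suc n)) *\<^sub>R ((of_nat (Suc n) * w) ^ m /\<^sub>R fact m)" for n m
  have norm_f: "norm (f n m) = exp (- a * real (Suc n)) * ((real (Suc n) * norm w) ^ m /\<^sub>R fact m)" for n m
    by (simp add: f_def norm_mult norm_power del: of_nat_Suc)
  have norm_sums: "(\<lambda>m. norm (f n m)) sums exp (real (Suc n) * (norm w - a))" for n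
  proof -
    have "(\<lambda>m. norm (f n m)) sums (exp (- a * real (Suc n)) * exp (real (Suc n) * norm w))"
      unfolding norm_f by (intro sums_mult exp_converges)
    then show ?thesis by (simp add: algebra_simps flip: exp_add)
  qed
  have f_sums: "f n sums exp (of_nat (Suc n) * (w - of_real a))" for n
  proof -
    have "f n sums (exp (- a * real (Suc n)) *\<^sub>R exp (of_nat (Suc n) * w))"
      unfolding f_def by (intro sums_scaleR_right exp_converges)
    also have "exp (- a * real (Suc n)) *\<^sub>R exp (of_nat (Suc n) * w) = exp (of_nat (Suc n) * (w - of_real a))"
      by (simp add: scaleR_conv_of_real algebra_simps exp_of_real[symmetric] flip: exp_add)
    finally show ?thesis .
  qed
  have row: "summable (\<lambda>m. norm (f n m))" for n
    using norm_sums[of n] by (rule sums_summable)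
  have rows: "summable (\<lambda>n. \<Sum>m. norm (f n m))"
    unfolding sums_unique[OF norm_sums, symmetric] using assms
    by (intro sums_summable[OF geometric_exp_sums[of "norm w - a", simplified of_nat_id]]) simp
  note swap = double_series_swap(2)[of f, OF row rows]
  have "(\<lambda>n. exp (of_nat (Suc n) * (w - of_real a))) sums (1 / (exp (of_real a - w) - 1))"
    using geometric_exp_sums[of "w - of_real a"] assms complex_Re_le_cmod[of w] by simp
  then have "(\<Sum>n. \<Sum>m. f n m) = 1 / (exp (of_real a - w) - 1)"
    unfolding sums_unique[OF f_sums, symmetric] by (rule sums_unique[symmetric])
  moreover have "(\<Sum>n. f n m) = of_real (exp_moment a m / fact m) * w ^ m" for m
  proof -
    have "(\<lambda>n. complex_of_real (real (Suc n) ^ m * exp (- a * real (Suc n)))) sums of_real (exp_moment a m)"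
      unfolding exp_moment_def using assms norm_ge_zero[of w]
      by (intro sums_of_real summable_sums summable_exp_moment) linarith
    then have "(\<lambda>n. complex_of_real (real (Suc n) ^ m * exp (- a * real (Suc n))) * (w ^ m / fact m))
        sums (of_real (exp_moment a m) * (w ^ m / fact m))"
      by (rule sums_mult2)
    moreover have "complex_of_real (real (Suc n) ^ m * exp (- a * real (Suc n))) * (w ^ m / fact m) = f n m" for n
      by (simp add: f_def scaleR_conv_of_real power_mult_distrib field_simps del: of_nat_Suc)
    ultimately show ?thesis by (simp add: sums_iff)
  qed
  ultimately show "(\<lambda>m. of_real (exp_moment a m / fact m) * w ^ m) sums (1 / (exp (of_real a - w) - 1))"
    using swap by simp
qed

section \<open>Removing the pole of the generating function\<close>

text \<open>The poles of 1 / (exp z - 1) are the multiples of 2 pi i. The circle about a of this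
  radius passes through 2 pi i and -2 pi i, so 0 is the only pole inside; it is simple with residue
  1, and subtracting 1 / z removes it.\<close>

lemma inverse_exp_minus_one_extension:
  assumes "a > 0"
  obtains g where "g holomorphic_on ball (complex_of_real a) (sqrt (a\<^sup>2 + (2 * pi)\<^sup>2))"
    and "\<And>z. z \<in> ball (complex_of_real a) (sqrt (a\<^sup>2 + (2 * pi)\<^sup>2)) \<Longrightarrow> z \<noteq> 0
           \<Longrightarrow> g z = 1 / (exp z - 1) - 1 / z"
proof -
  define S where "S = ball (complex_of_real a) (sqrt (a\<^sup>2 + (2 * pi)\<^sup>2))"
  have nonzero: "exp z \<noteq> 1" if "z \<in> S" "z \<noteq> 0" for z
  proof
    assume "exp z = 1"
    then obtain n :: int where n: "Re z = 0" "Im z = of_int (2 * n) * pi"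
      by (auto simp: exp_eq_1)
    with \<open>z \<noteq> 0\<close> have "n \<noteq> 0" by (auto simp: complex_eq_iff)
    then have "1 \<le> n\<^sup>2" by (metis int_one_le_iff_zero_less zero_less_power2)
    then have "1 \<le> (of_int n :: real)\<^sup>2" by (metis of_int_1_le_iff of_int_power)
    then have "(2 * pi)\<^sup>2 \<le> (Im z)\<^sup>2"
      by (simp add: n power_mult_distrib)
    moreover have "(norm (complex_of_real a - z))\<^sup>2 < (sqrt (a\<^sup>2 + (2 * pi)\<^sup>2))\<^sup>2"
      using that(1) by (intro power_strict_mono) (auto simp: S_def dist_norm)
    ultimately show False by (simp add: cmod_power2 n)
  qed
  \<comment> \<open>Removability at 0 requires z times the function to tend to 0. That product is 1
    / ((exp z - 1) / z) - 1, and the difference quotient tends to exp'(0) = 1.\<close>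
  have "((\<lambda>h. (exp (0 + h) - exp 0) / h) \<longlongrightarrow> (1 :: complex)) (at 0)"
    using DERIV_exp[of "0 :: complex"] by (simp add: has_field_derivative_iff)
  then have "((\<lambda>z. inverse ((exp z - 1) / z) - 1) \<longlongrightarrow> (inverse 1 - 1 :: complex)) (at 0)"
    by (intro tendsto_intros) auto
  moreover have "eventually (\<lambda>z. inverse ((exp z - 1) / z) - 1 = (z - 0) * (1 / (exp z - 1) - 1 / z)) (at (0 :: complex))"
    by (auto simp: eventually_at_filter field_simps)
  ultimately have "((\<lambda>z. (z - 0) * (1 / (exp z - 1) - 1 / z)) \<longlongrightarrow> (0 :: complex)) (at 0)"
    by (simp add: tendsto_cong)
  moreover have "0 \<in> interior S"
    using assms by (simp add: S_def interior_open real_less_rsqrt)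
  moreover have "(\<lambda>z. 1 / (exp z - 1) - 1 / z) holomorphic_on S - {0}"
    using nonzero by (intro holomorphic_intros) auto
  ultimately obtain g where "g holomorphic_on S" "\<forall>z \<in> S - {0}. g z = 1 / (exp z - 1) - 1 / z"
    using holomorphic_on_extend_lim[of "\<lambda>z. 1 / (exp z - 1) - 1 / z" S 0] by auto
  with that show thesis unfolding S_def by auto
qed

text \<open>The Taylor coefficient at w = 0 of 1 / (exp(a - w) - 1) - 1 / (a - w), for a >
  0.\<close>

definition exp_moment_excess :: "real \<Rightarrow> nat \<Rightarrow> real" where
  "exp_moment_excess a m = exp_moment a m / fact m - 1 / a ^ Suc m"

text \<open>The generating function of the excess extends holomorphically to a disc about 0 of
  radius \<open>R\<close> > a, so its Taylor series converges absolutely at the point a.\<close>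

lemma summable_exp_moment_excess:
  assumes "a > 0"
  shows "summable (\<lambda>m. \<bar>exp_moment_excess a m\<bar> * a ^ m)"
proof -
  define R where "R = sqrt (a\<^sup>2 + (2 * pi)\<^sup>2)"
  have R: "a < R" using assms by (simp add: R_def real_less_rsqrt)
  obtain g where g: "g holomorphic_on ball (complex_of_real a) R"
    and g_eq: "\<And>z. z \<in> ball (complex_of_real a) R \<Longrightarrow> z \<noteq> 0 \<Longrightarrow> g z = 1 / (exp z - 1) - 1 / z"
    using inverse_exp_minus_one_extension[OF assms] unfolding R_def by blast
  define G where "G w = g (of_real a - w)" for w
  have "G holomorphic_on eball 0 (ereal R)"
    unfolding G_def by (rule holomorphic_on_compose_gen[OF _ g, unfolded o_def])
      (auto intro!: holomorphic_intros simp: dist_norm)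
  moreover have expansion: "G has_fps_expansion Abs_fps (\<lambda>m. of_real (exp_moment_excess a m))"
  proof (rule has_fps_expansionI)
    \<comment> \<open>For |w| < a the moment series and the geometric series of the pole both
      converge. This identifies the Taylor coefficients of \<open>G\<close>; its holomorphy then
      gives the larger radius.\<close>
    have "(\<lambda>m. of_real (exp_moment_excess a m) * w ^ m) sums G w" if w: "norm w < a" for w
    proof -
      have "norm (w / of_real a) < 1" using w assms by (simp add: norm_divide)
      then have "(\<lambda>m. 1 / of_real a * (w / of_real a) ^ m) sums (1 / of_real a * (1 / (1 - w / of_real a)))"
        by (intro sums_mult geometric_sums)
      then have "(\<lambda>m. of_real (1 / a ^ Suc m) * w ^ m) sums (1 / (of_real a - w))"
        using assms by (simp add: power_divide field_simps)
      from sums_diff[OF exp_moment_generating_function[OF w] this]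
      have "(\<lambda>m. of_real (exp_moment_excess a m) * w ^ m) sums (1 / (exp (of_real a - w) - 1) - 1 / (of_real a - w))"
        by (simp add: exp_moment_excess_def left_diff_distrib)
      moreover have "of_real a - w \<noteq> 0" using w assms by auto
      moreover have "of_real a - w \<in> ball (complex_of_real a) R" using w R by (simp add: dist_norm)
      ultimately show ?thesis by (simp add: G_def g_eq)
    qed
    moreover have "eventually (\<lambda>w. norm w < a) (nhds (0 :: complex))"
      using eventually_nhds_in_open[of "ball (0 :: complex) a" 0] assms by simp
    ultimately show "eventually (\<lambda>w. (\<lambda>m. fps_nth (Abs_fps (\<lambda>m. of_real (exp_moment_excess a m))) m * w ^ m) sums G w) (nhds 0)"
      by (simp add: eventually_mono)
  qed
  ultimately have "ereal R \<le> fps_conv_radius (Abs_fps (\<lambda>m. complex_of_real (exp_moment_excess a m)))"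
    by (intro holomorphic_on_imp_fps_conv_radius_ge)
  moreover have "ereal (norm (complex_of_real a)) < ereal R" using R assms by simp
  ultimately have "ereal (norm (complex_of_real a)) < fps_conv_radius (Abs_fps (\<lambda>m. complex_of_real (exp_moment_excess a m)))"
    by (rule order.strict_trans2[rotated])
  from norm_summable_fps[OF this] show ?thesis
    using assms by (simp add: norm_mult norm_power)
qed

section \<open>Even exponential series and Abel summation of alternating series\<close>

lemma
  fixes x :: real
  assumes "x \<ge> 0"
  shows summable_even_exp: "summable (\<lambda>k. x ^ (2 * k) / fact (2 * k))"
    and suminf_even_exp_le: "(\<Sum>k. x ^ (2 * k) / fact (2 * k)) \<le> exp x"
proof -
  have sums: "(\<lambda>k. x ^ k / fact k) sums exp x"
    using exp_converges[of x] by (simp add: field_simps)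
  have nonneg: "0 \<le> x ^ k / fact k" for k using assms by simp
  have inj: "inj ((*) (2 :: nat))" by (auto intro: injI)
  show "summable (\<lambda>k. x ^ (2 * k) / fact (2 * k))"
    using summable_reindex[OF sums_summable[OF sums] inj nonneg] by (simp add: o_def)
  show "(\<Sum>k. x ^ (2 * k) / fact (2 * k)) \<le> exp x"
    using suminf_reindex_mono[OF sums_summable[OF sums] inj nonneg] sums_unique[OF sums] by (simp add: o_def)
qed

text \<open>The terms v(k) t^k still decrease to 0 for t in [0, 1], and the Leibniz error after 2n
  terms is at most v(2n) for every such t. Convergence is thus uniform up to t = 1, as in Abel's
  limit theorem.\<close>

lemma alternating_series_continuous:
  fixes v :: "nat \<Rightarrow> real"
  assumes dec: "decseq v" and lim: "v \<longlonglongrightarrow> 0"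
  shows "continuous_on {0..1} (\<lambda>t. \<Sum>k. (-1) ^ k * (v k * t ^ k))"
proof (rule uniform_limit_theorem)
  have nonneg: "v k \<ge> 0" for k by (rule decseq_ge[OF dec lim])
  show "uniform_limit {0..1} (\<lambda>n t. \<Sum>k<2 * n. (-1) ^ k * (v k * t ^ k))
      (\<lambda>t. \<Sum>k. (-1) ^ k * (v k * t ^ k)) sequentially"
  proof (rule uniform_limitI)
    fix e :: real
    assume "e > 0"
    have "filterlim (\<lambda>n. 2 * n :: nat) sequentially sequentially"
      by (intro filterlim_subseq strict_monoI) auto
    with lim have "(\<lambda>n. v (2 * n)) \<longlonglongrightarrow> 0"
      by (rule filterlim_compose)
    then have "eventually (\<lambda>n. v (2 * n) < e) sequentially"
      by (rule order_tendstoD(2)) fact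
    then show "\<forall>\<^sub>F n in sequentially. \<forall>t\<in>{0..1}.
        dist (\<Sum>k<2 * n. (-1) ^ k * (v k * t ^ k)) (\<Sum>k. (-1) ^ k * (v k * t ^ k)) < e"
    proof eventually_elim
      case (elim n)
      show ?case
      proof
        fix t :: real
        assume t: "t \<in> {0..1}"
        have le: "v k * t ^ k \<le> v k" for k
          using t nonneg[of k] by (intro mult_left_le power_le_one) auto
        have lim': "(\<lambda>k. v k * t ^ k) \<longlonglongrightarrow> 0"
          by (rule tendsto_sandwich[OF _ _ tendsto_const lim]) (use t nonneg le in auto)
        have nonneg': "0 \<le> v k * t ^ k" for k using t nonneg[of k] by auto
        have dec': "v (Suc k) * t ^ Suc k \<le> v k * t ^ k" for k
          using t nonneg decseq_SucD[OF dec, of k] by (intro mult_mono power_decreasing) auto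
        \<comment> \<open>The sum lies between the partial sums of lengths 2n and 2n + 1, which
          differ by v(2n) t^(2n).\<close>
        note leibniz = summable_Leibniz'[OF lim' nonneg' dec']
        show "dist (\<Sum>k<2 * n. (-1) ^ k * (v k * t ^ k)) (\<Sum>k. (-1) ^ k * (v k * t ^ k)) < e"
          using leibniz(2)[of n] leibniz(4)[of n] le[of "2 * n"] elim by (simp add: dist_real_def)
      qed
    qed
  qed
qed (auto intro!: always_eventually continuous_intros)

section \<open>The summation formula, first inside and then up to the boundary\<close>

text \<open>Here c stands for b^2. The absolute row sums are bounded by a constant times exp(n (sqrt
  c - a)), which is summable exactly because c < a^2.\<close>

lemma bessel_exp_sum_swap:
  assumes "\<nu> > - 1 / 2" "a > 0" "c \<ge> 0" "c < a\<^sup>2"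
  shows "(\<lambda>k. bessel_coeff \<nu> k * c ^ k * exp_moment a (2 * k)) sums
    (\<Sum>n. exp (- a * real (Suc n)) * bessel_entire \<nu> (c * (real (Suc n))\<^sup>2))"
proof -
  define f where "f n k = exp (- a * real (Suc n)) * (bessel_coeff \<nu> k * (c * (real (Suc n))\<^sup>2) ^ k)" for n k
  have row: "summable (\<lambda>k. norm (f n k))" for n
    unfolding f_def norm_mult[of "exp _"]
    by (intro summable_mult summable_bessel_coeff assms)
  define x where "x n = sqrt c * real (Suc n)" for n
  have x_nonneg: "x n \<ge> 0" for n using assms by (simp add: x_def)
  have row_le: "(\<Sum>k. norm (f n k)) \<le> bessel_weight \<nu> 0 * exp (of_nat (Suc n) * (sqrt c - a))" for n
  proof -
    have "norm (f n k) \<le> exp (- a * real (Suc n)) * bessel_weight \<nu> 0 * (x n ^ (2 * k) / fact (2 * k))" for k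
    proof -
      have "c * (real (Suc n))\<^sup>2 = (x n)\<^sup>2"
        using assms(3) by (simp add: x_def power_mult_distrib del: of_nat_Suc)
      then have "norm (f n k) = exp (- a * real (Suc n)) * (\<bar>bessel_coeff \<nu> k\<bar> * x n ^ (2 * k))"
        using x_nonneg[of n] by (simp add: f_def abs_mult power_mult)
      also have "\<dots> \<le> exp (- a * real (Suc n)) * (bessel_weight \<nu> 0 / fact (2 * k) * x n ^ (2 * k))"
        using x_nonneg[of n] by (intro mult_left_mono mult_right_mono abs_bessel_coeff_le assms) auto
      finally show ?thesis by simp
    qed
    then have "(\<Sum>k. norm (f n k)) \<le> (\<Sum>k. exp (- a * real (Suc n)) * bessel_weight \<nu> 0 * (x n ^ (2 * k) / fact (2 * k)))"
      by (intro suminf_le row summable_mult summable_even_exp x_nonneg)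
    also have "\<dots> = exp (- a * real (Suc n)) * bessel_weight \<nu> 0 * (\<Sum>k. x n ^ (2 * k) / fact (2 * k))"
      by (intro suminf_mult summable_even_exp x_nonneg)
    also have "\<dots> \<le> exp (- a * real (Suc n)) * bessel_weight \<nu> 0 * exp (x n)"
      using bessel_weight_pos[OF assms(1), of 0] by (intro mult_left_mono suminf_even_exp_le x_nonneg) auto
    also have "\<dots> = bessel_weight \<nu> 0 * exp (of_nat (Suc n) * (sqrt c - a))"
      by (simp add: x_def algebra_simps flip: exp_add)
    finally show ?thesis .
  qed
  have rows: "summable (\<lambda>n. \<Sum>k. norm (f n k))"
  proof (rule summable_comparison_test')
    have "sqrt c < a" using assms by (simp add: real_less_lsqrt)
    then show "summable (\<lambda>n. bessel_weight \<nu> 0 * exp (of_nat (Suc n) * (sqrt c - a)))"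
      by (intro summable_mult sums_summable[OF geometric_exp_sums]) simp
    show "norm (\<Sum>k. norm (f n k)) \<le> bessel_weight \<nu> 0 * exp (of_nat (Suc n) * (sqrt c - a))" for n
      using row_le[of n] suminf_nonneg[OF row[of n]] by simp
  qed
  have "(\<lambda>k. \<Sum>n. f n k) sums (\<Sum>n. \<Sum>k. f n k)"
    by (rule double_series_swap(2)[OF row rows])
  moreover have "(\<Sum>n. f n k) = bessel_coeff \<nu> k * c ^ k * exp_moment a (2 * k)" for k
  proof -
    have "f n k = bessel_coeff \<nu> k * c ^ k * (real (Suc n) ^ (2 * k) * exp (- a * real (Suc n)))" for n
      by (simp add: f_def power_mult_distrib power_mult del: of_nat_Suc)
    then show ?thesis
      unfolding exp_moment_def by (simp only: suminf_mult[OF summable_exp_moment[OF assms(2)]])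
  qed
  moreover have "(\<Sum>k. f n k) = exp (- a * real (Suc n)) * bessel_entire \<nu> (c * (real (Suc n))\<^sup>2)" for n
    unfolding f_def bessel_entire_def
    by (intro suminf_mult summable_norm_cancel[OF summable_bessel_coeff] assms)
  ultimately show ?thesis by simp
qed

text \<open>The boundary case c = a^2 is reached by replacing c with t c and letting t tend to 1
  from below. Both sides are continuous in this limit.\<close>

lemma bessel_exp_sum:
  assumes "\<nu> > - 1 / 2" "a > 0" "c \<ge> 0" "c \<le> a\<^sup>2"
  shows "summable (\<lambda>n. exp (- a * real (Suc n)) * bessel_entire \<nu> (c * (real (Suc n))\<^sup>2))"
    and "(\<lambda>k. bessel_coeff \<nu> k * c ^ k * exp_moment a (2 * k)) sums
      (\<Sum>n. exp (- a * real (Suc n)) * bessel_entire \<nu> (c * (real (Suc n))\<^sup>2))"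
proof -
  define L where "L t = (\<Sum>n. exp (- a * real (Suc n)) * bessel_entire \<nu> (t * c * (real (Suc n))\<^sup>2))" for t
  \<comment> \<open>\<open>V\<close> comes from the pole and gives the alternating series
    \<open>P\<close>; \<open>D\<close> comes from the excess and gives the absolutely convergent
    series \<open>Q\<close>.\<close>
  define V where "V k = bessel_weight \<nu> k * (c ^ k / a ^ Suc (2 * k))" for k
  define D where "D k = (-1) ^ k * bessel_weight \<nu> k * c ^ k * exp_moment_excess a (2 * k)" for k
  define P where "P t = (\<Sum>k. (-1) ^ k * (V k * t ^ k))" for t
  define Q where "Q t = (\<Sum>k. D k * t ^ k)" for t
  have split: "bessel_coeff \<nu> k * (t * c) ^ k * exp_moment a (2 * k) = (-1) ^ k * (V k * t ^ k) + D k * t ^ k" for t k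
  proof -
    have "bessel_coeff \<nu> k * (t * c) ^ k * exp_moment a (2 * k)
        = (-1) ^ k * bessel_weight \<nu> k * c ^ k * t ^ k * (exp_moment a (2 * k) / fact (2 * k))"
      by (simp add: bessel_coeff_eq_weight power_mult_distrib)
    also have "exp_moment a (2 * k) / fact (2 * k) = exp_moment_excess a (2 * k) + 1 / a ^ Suc (2 * k)"
      by (simp add: exp_moment_excess_def)
    finally show ?thesis by (simp add: V_def D_def algebra_simps)
  qed

  \<comment> \<open>As q \<le> 1, \<open>V\<close> inherits monotonicity and the limit 0 from the
    weight; at q = 1 the weight alone provides the decay.\<close>
  define q where "q = c / a\<^sup>2"
  have q: "0 \<le> q" "q \<le> 1" using assms by (auto simp: q_def)
  have V_eq: "V k = bessel_weight \<nu> k * (q ^ k / a)" for k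
    by (simp add: V_def q_def power_divide power_mult)
  have V_dec: "decseq V"
  proof (rule decseq_SucI)
    show "V (Suc k) \<le> V k" for k
      unfolding V_eq using q assms bessel_weight_pos[OF assms(1), of k] decseq_SucD[OF bessel_weight_decseq[OF assms(1)], of k]
      by (intro mult_mono divide_right_mono power_decreasing) auto
  qed
  have V_lim: "V \<longlonglongrightarrow> 0"
  proof (rule tendsto_sandwich[OF _ _ tendsto_const])
    show "(\<lambda>k. bessel_weight \<nu> k * (1 / a)) \<longlonglongrightarrow> 0"
      using tendsto_mult_left_zero[OF bessel_weight_tendsto_0[OF assms(1)]] .
    have "V k \<le> bessel_weight \<nu> k * (1 / a)" for k
      unfolding V_eq using q assms bessel_weight_pos[OF assms(1), of k]
      by (intro mult_left_mono divide_right_mono power_le_one) auto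
    then show "\<forall>\<^sub>F k in sequentially. V k \<le> bessel_weight \<nu> k * (1 / a)" by simp
    have "0 \<le> V k" for k
      unfolding V_eq using q assms bessel_weight_pos[OF assms(1), of k] by simp
    then show "\<forall>\<^sub>F k in sequentially. 0 \<le> V k" by simp
  qed
  have V_summable: "summable (\<lambda>k. (-1) ^ k * (V k * t ^ k))" if t: "t \<in> {0..1}" for t
  proof (rule summable_Leibniz'(1))
    have nonneg: "V k \<ge> 0" for k by (rule decseq_ge[OF V_dec V_lim])
    have le: "V k * t ^ k \<le> V k" for k
      using t nonneg[of k] by (intro mult_left_le power_le_one) auto
    show "(\<lambda>k. V k * t ^ k) \<longlonglongrightarrow> 0"
      by (rule tendsto_sandwich[OF _ _ tendsto_const V_lim]) (use t nonneg le in auto)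
    show "0 \<le> V k * t ^ k" for k using t nonneg[of k] by auto
    show "V (Suc k) * t ^ Suc k \<le> V k * t ^ k" for k
      using t nonneg decseq_SucD[OF V_dec, of k] by (intro mult_mono power_decreasing) auto
  qed

  \<comment> \<open>The weight is at most its value at 0 and c^k \<le> a^(2k), so the even-indexed
    part of the excess series at a is a majorant.\<close>
  have D_summable: "summable (\<lambda>k. \<bar>D k\<bar>)"
  proof (rule summable_comparison_test')
    have "summable ((\<lambda>m. \<bar>exp_moment_excess a m\<bar> * a ^ m) \<circ> (*) 2)"
      using assms by (intro summable_reindex summable_exp_moment_excess) (auto intro: injI)
    then show "summable (\<lambda>k. bessel_weight \<nu> 0 * (\<bar>exp_moment_excess a (2 * k)\<bar> * a ^ (2 * k)))"
      by (intro summable_mult) (simp add: o_def)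
    fix k :: nat
    have "\<bar>D k\<bar> = bessel_weight \<nu> k * (\<bar>exp_moment_excess a (2 * k)\<bar> * c ^ k)"
      using assms bessel_weight_pos[OF assms(1), of k] by (simp add: D_def abs_mult)
    also have "\<dots> \<le> bessel_weight \<nu> 0 * (\<bar>exp_moment_excess a (2 * k)\<bar> * (a\<^sup>2) ^ k)"
      using assms bessel_weight_pos[OF assms(1), of 0] decseqD[OF bessel_weight_decseq[OF assms(1)], of 0 k]
      by (intro mult_mono power_mono mult_nonneg_nonneg) auto
    finally show "norm \<bar>D k\<bar> \<le> bessel_weight \<nu> 0 * (\<bar>exp_moment_excess a (2 * k)\<bar> * a ^ (2 * k))"
      by (simp add: power_mult)
  qed
  have D_le: "norm (D k * t ^ k) \<le> \<bar>D k\<bar>" if "t \<in> {0..1}" for t k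
    using that by (auto simp: abs_mult intro!: mult_left_le power_le_one)
  have D_summable': "summable (\<lambda>k. D k * t ^ k)" if "t \<in> {0..1}" for t
    using D_le[OF that] by (intro summable_comparison_test'[OF D_summable])

  have sums: "(\<lambda>k. bessel_coeff \<nu> k * (t * c) ^ k * exp_moment a (2 * k)) sums (P t + Q t)" if "t \<in> {0..1}" for t
    unfolding split P_def Q_def using that by (intro sums_add summable_sums V_summable D_summable')

  have near: "eventually (\<lambda>t. t \<in> {0<..<1}) (at_left (1 :: real))"
    using eventually_at_left_real[of 0 "1 :: real"] by simp
  then have near_prod: "eventually (\<lambda>(k :: nat, t). t \<in> {0<..<1}) (at_top \<times>\<^sub>F at_left (1 :: real))"
    by (subst eventually_prod2) auto
  have "continuous_on {0..1} P"
    unfolding P_def by (rule alternating_series_continuous[OF V_dec V_lim])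
  then have "(P \<longlongrightarrow> P 1) (at 1 within {0..1})" by (simp add: continuous_on_def)
  then have P_lim: "(P \<longlongrightarrow> P 1) (at_left 1)"
    by (simp add: at_within_Icc_at_left)
  have "((\<lambda>t. \<Sum>k. D k * t ^ k) \<longlongrightarrow> (\<Sum>k. D k * 1 ^ k)) (at_left 1)"
  proof (rule tannerys_theorem[THEN conjunct2, THEN conjunct2])
    show "((\<lambda>t. D k * t ^ k) \<longlongrightarrow> D k * 1 ^ k) (at_left 1)" for k
      by (intro tendsto_intros)
    show "\<forall>\<^sub>F (k, t) in at_top \<times>\<^sub>F at_left 1. norm (D k * t ^ k) \<le> \<bar>D k\<bar>"
      by (rule eventually_mono[OF near_prod]) (use D_le in auto)
  qed (use D_summable in auto)
  then have Q_lim: "(Q \<longlongrightarrow> Q 1) (at_left 1)" by (simp add: Q_def[abs_def])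

  define l where "l n t = exp (- a * real (Suc n)) * bessel_entire \<nu> (t * c * (real (Suc n))\<^sup>2)" for n t
  \<comment> \<open>The bound of the normalised Bessel function by its value at 0 gives a geometric
    majorant independent of t. Tannery's theorem then yields both absolute convergence at t = 1 and
    the limit of \<open>L\<close>.\<close>
  have "eventually (\<lambda>t. summable (\<lambda>n. norm (l n t))) (at_left 1) \<and> summable (\<lambda>n. norm (l n 1)) \<and>
      ((\<lambda>t. \<Sum>n. l n t) \<longlongrightarrow> (\<Sum>n. l n 1)) (at_left 1)"
  proof (rule tannerys_theorem)
    show "((\<lambda>t. l n t) \<longlongrightarrow> l n 1) (at_left 1)" for n
      unfolding l_def by (intro tendsto_intros isCont_tendsto_compose[OF bessel_entire_isCont[OF assms(1)]])
    have "norm (l n t) \<le> \<bar>bessel_entire \<nu> 0\<bar> * exp (- a * real (Suc n))" if "t \<in> {0<..<1}" for n t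
      using that assms bessel_entire_bound[OF assms(1), of "t * c * (real (Suc n))\<^sup>2"]
      by (simp add: l_def abs_mult del: of_nat_Suc)
    then show "\<forall>\<^sub>F (n, t) in at_top \<times>\<^sub>F at_left 1. norm (l n t) \<le> \<bar>bessel_entire \<nu> 0\<bar> * exp (- a * real (Suc n))"
      by (intro eventually_mono[OF near_prod]) auto
    show "summable (\<lambda>n. \<bar>bessel_entire \<nu> 0\<bar> * exp (- a * real (Suc n)))"
      using summable_exp_moment[OF assms(2), of 0] by (intro summable_mult) simp
  qed auto
  then have l_summable: "summable (\<lambda>n. norm (l n 1))" and L_lim: "(L \<longlongrightarrow> L 1) (at_left 1)"
    by (auto simp: l_def L_def[abs_def])
  show "summable (\<lambda>n. exp (- a * real (Suc n)) * bessel_entire \<nu> (c * (real (Suc n))\<^sup>2))"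
    using summable_norm_cancel[OF l_summable] by (simp add: l_def)

  have "L t = P t + Q t" if t: "t \<in> {0<..<1}" for t
  proof -
    \<comment> \<open>Scaling by t < 1 makes the inequality strict only when c > 0; for c = 0 it is
      just 0 < a^2.\<close>
    have "t * c < a\<^sup>2"
    proof (cases "c = 0")
      case False
      with t assms have "t * c < 1 * c" by (intro mult_strict_right_mono) auto
      with assms show ?thesis by simp
    qed (use assms in auto)
    then have "(\<lambda>k. bessel_coeff \<nu> k * (t * c) ^ k * exp_moment a (2 * k)) sums L t"
      unfolding L_def using t assms by (intro bessel_exp_sum_swap) auto
    with sums[of t] t show ?thesis by (auto dest: sums_unique2)
  qed
  then have "eventually (\<lambda>t. L t = P t + Q t) (at_left 1)"
    by (rule eventually_mono[OF near])
  with L_lim have "((\<lambda>t. P t + Q t) \<longlongrightarrow> L 1) (at_left 1)"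
    by (simp add: tendsto_cong)
  moreover have "((\<lambda>t. P t + Q t) \<longlongrightarrow> P 1 + Q 1) (at_left 1)"
    by (intro tendsto_add P_lim Q_lim)
  ultimately have "L 1 = P 1 + Q 1"
    by (intro tendsto_unique[of "at_left (1 :: real)"]) auto
  with sums[of 1] show "(\<lambda>k. bessel_coeff \<nu> k * c ^ k * exp_moment a (2 * k)) sums
      (\<Sum>n. exp (- a * real (Suc n)) * bessel_entire \<nu> (c * (real (Suc n))\<^sup>2))"
    by (simp add: L_def)
qed

section \<open>Translation to Bessel functions and polylogarithms\<close>

theorem mainTheorem4:
  fixes a b \<nu> :: real
  assumes "a > 0" and "b > 0" and "\<nu> > - 1 / 2" and "a \<ge> b"
  shows "summable (\<lambda>n. exp (- a * real (Suc n)) / (1 / 2 * b * real (Suc n)) powr \<nu>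
                         * bessel_J \<nu> (b * real (Suc n)))
       \<and> summable (\<lambda>k. (-1) ^ k * (1 / 2 * b) ^ (2 * k) / (fact k * Gamma (1 + \<nu> + real k))
                         * polylog (- 2 * real k) (exp (- a)))
       \<and> (\<Sum>n. exp (- a * real (Suc n)) / (1 / 2 * b * real (Suc n)) powr \<nu>
                         * bessel_J \<nu> (b * real (Suc n)))
         = (\<Sum>k. (-1) ^ k * (1 / 2 * b) ^ (2 * k) / (fact k * Gamma (1 + \<nu> + real k))
                         * polylog (- 2 * real k) (exp (- a)))"
proof -
  have bessel: "exp (- a * real (Suc n)) / (1 / 2 * b * real (Suc n)) powr \<nu> * bessel_J \<nu> (b * real (Suc n))
      = exp (- a * real (Suc n)) * bessel_entire \<nu> (b\<^sup>2 * (real (Suc n))\<^sup>2)" for n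
  proof -
    have "b * real (Suc n) > 0" using assms by simp
    from arg_cong[OF bessel_J_conv_entire[OF assms(3) this], of "\<lambda>y. exp (- a * real (Suc n)) * y"] show ?thesis
      by (simp add: power_mult_distrib del: of_nat_Suc)
  qed
  have polylog: "polylog (- 2 * real k) (exp (- a)) = exp_moment a (2 * k)" for k
  proof -
    have "real (Suc n) powr (- (- 2 * real k)) = real (Suc n) ^ (2 * k)" for n
      using powr_realpow[of "real (Suc n)" "2 * k"] by simp
    moreover have "exp (- a) ^ Suc n = exp (- a * real (Suc n))" for n
      by (simp only: exp_of_nat2_mult)
    ultimately show ?thesis unfolding polylog_def exp_moment_def by presburger
  qed
  have coeff: "(-1) ^ k * (1 / 2 * b) ^ (2 * k) / (fact k * Gamma (1 + \<nu> + real k)) = bessel_coeff \<nu> k * (b\<^sup>2) ^ k" for k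
  proof -
    have "(1 / 2 * b) ^ (2 * k) = (b\<^sup>2) ^ k / 4 ^ k"
      by (simp add: power_mult power_divide)
    then show ?thesis by (simp add: bessel_coeff_def)
  qed
  \<comment> \<open>With c = b^2 the condition b \<le> a becomes c \<le> a^2, including the boundary
    case.\<close>
  have "b\<^sup>2 \<le> a\<^sup>2" using assms by (intro power_mono) auto
  with bessel_exp_sum[OF assms(3,1), of "b\<^sup>2"] show ?thesis
    unfolding bessel polylog coeff by (auto simp: sums_iff)
qed

end
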